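(* Let $X_\Sigma$ be a normal compact toric variety with dense open torus $T=(\mathbb C^* )^n$, and let $V\subset T$ be a closed reduced analytic subvariety with analytic ideal sheaf $\mathcal I_V\subset\mathcal O_T$. Then $V$ is of finite logarithmic type with respect to $X_\Sigma$ if and only if there exist a coherent analytic subsheaf $\mathcal F\subset\mathcal M_{X_\Sigma}$ with $\mathcal F|_T=\mathcal I_V$ and nonnegative integers $M_\rho$, one for each $\rho\in\Sigma(1)$, such that for every open set $U\subset X_\Sigma$, every section $g\in\mathcal F(U)$, and every ray $\rho\in\Sigma(1)$ with $D_\rho\cap U\neq\varnothing$, one has $\operatorname{ord}_{D_\rho}(g)\ge -M_\rho$.
   Context: $\Sigma$ is the fan of $X_\Sigma$, $\Sigma(1)$ its set of rays, and $D_\rho$ the torus-invariant prime divisor corresponding to $\rho\in\Sigma(1)$, so $X_\Sigma\setminus T=\bigcup_\rho D_\rho$. $\mathcal M_{X_\Sigma}$ is the sheaf of meromorphic functions on the complex analytic space $X_\Sigma$, and $\operatorname{ord}_{D_\rho}$ is the order of vanishing along $D_\rho$ (negative for poles, $+\infty$ for the zero function). For an effective torus-invariant divisor $E=\sum_\rho M_\rho D_\rho$, $\mathcal O_{X_\Sigma}(E)\subset\mathcal M_{X_\Sigma}$ is the sheaf of meromorphic functions with pole order at most $M_\rho$ along each $D_\rho$ and no other poles, i.e. $\mathrm{div}(g)+E\ge0$; canonically $\mathcal O_{X_\Sigma}(E)|_T=\mathcal O_T$. $V$ is of finite logarithmic type with respect to $X_\Sigma$ if there exist an effective torus-invariant divisor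 $E$ and a coherent analytic subsheaf $\mathcal J\subset\mathcal O_{X_\Sigma}(E)$ such that $\mathcal J|_T=\mathcal I_V$ under the canonical identification $\mathcal O_{X_\Sigma}(E)|_T=\mathcal O_T$. *)

theory Defs
  imports "HOL-Analysis.Analysis"
begin

section \<open>Fans in \<open>\<real>\<^sup>n\<close> with respect to the lattice \<open>\<int>\<^sup>n\<close>\<close>

text \<open>The cocharacter lattice is the set of integral vectors of \<open>real ^ 'n\<close>; the character
  lattice is the type \<open>int ^ 'n\<close>.\<close>

definition lattice_vector :: "int ^ 'n \<Rightarrow> real ^ 'n" where
  "lattice_vector b = (\<chi> i. of_int (b $ i))"

definition pairing :: "int ^ 'n \<Rightarrow> real ^ 'n \<Rightarrow> real" where
  "pairing m u = (\<Sum>i\<in>UNIV. of_int (m $ i) * u $ i)"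

definition rational_polyhedral_cone :: "(real ^ 'n) set \<Rightarrow> bool" where
  "rational_polyhedral_cone \<sigma> \<longleftrightarrow>
     (\<exists>B :: (int ^ 'n) set. finite B \<and> \<sigma> = convex_cone hull (lattice_vector ` B))"

definition strongly_convex :: "(real ^ 'n) set \<Rightarrow> bool" where
  "strongly_convex \<sigma> \<longleftrightarrow> \<sigma> \<inter> uminus ` \<sigma> = {0}"

text \<open>The library relation \<open>face_of\<close> also admits the empty face, which is not a cone.\<close>

definition fan :: "(real ^ 'n) set set \<Rightarrow> bool" where
  "fan \<Sigma> \<longleftrightarrow> finite \<Sigma> \<and> \<Sigma> \<noteq> {} \<and>
     (\<forall>\<sigma>\<in>\<Sigma>. rational_polyhedral_cone \<sigma> \<and> strongly_convex \<sigma>) \<and>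
     (\<forall>\<sigma>\<in>\<Sigma>. \<forall>\<tau>. \<tau> face_of \<sigma> \<and> \<tau> \<noteq> {} \<longrightarrow> \<tau> \<in> \<Sigma>) \<and>
     (\<forall>\<sigma>\<in>\<Sigma>. \<forall>\<sigma>'\<in>\<Sigma>. (\<sigma> \<inter> \<sigma>') face_of \<sigma> \<and> (\<sigma> \<inter> \<sigma>') face_of \<sigma>')"

definition rays :: "(real ^ 'n) set set \<Rightarrow> (real ^ 'n) set set" where
  "rays \<Sigma> = {\<rho>\<in>\<Sigma>. dim \<rho> = 1}"

definition dual_semigroup :: "(real ^ 'n) set \<Rightarrow> (int ^ 'n) set" where
  "dual_semigroup \<sigma> = {m. \<forall>u\<in>\<sigma>. 0 \<le> pairing m u}"


section \<open>The toric variety as a topological space\<close>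

text \<open>
  The points of the affine chart of \<open>\<sigma>\<close> are the monoid homomorphisms from
  \<open>dual_semigroup \<sigma>\<close> to the multiplicative monoid of \<open>\<complex>\<close>, and a point of the chart of a face
  \<open>\<tau>\<close> is glued to its restriction to \<open>dual_semigroup \<sigma>\<close>.  Each point of the glued space is
  represented here in the smallest chart containing it, that is, in the chart of the cone
  \<open>\<tau>\<close> whose torus orbit contains it; there, exactly the invertible characters do not vanish.
  So a point \<open>x\<close> is the partial function that sends a character \<open>m\<close> regular at \<open>x\<close> to its
  value \<open>the (x m)\<close>.  In the chart of \<open>\<sigma>\<close> every \<open>m \<in> dual_semigroup \<sigma>\<close> is regular,
  and the homomorphism on \<open>dual_semigroup \<sigma>\<close> is recovered by restriction.
\<close>

type_synonym 'n point = "int ^ 'n \<Rightarrow> complex option"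

definition orbit :: "(real ^ 'n) set \<Rightarrow> 'n point set" where
  "orbit \<tau> = {x. dom x = dual_semigroup \<tau> \<and> x 0 = Some 1 \<and>
     (\<forall>a\<in>dual_semigroup \<tau>. \<forall>b\<in>dual_semigroup \<tau>. the (x (a + b)) = the (x a) * the (x b)) \<and>
     (\<forall>a\<in>dual_semigroup \<tau>. the (x a) \<noteq> 0 \<longleftrightarrow> - a \<in> dual_semigroup \<tau>)}"

definition chart :: "(real ^ 'n) set \<Rightarrow> 'n point set" where
  "chart \<sigma> = (\<Union>\<tau>\<in>{\<tau>. \<tau> face_of \<sigma> \<and> \<tau> \<noteq> {}}. orbit \<tau>)"

text \<open>Each chart is open and carries the coarsest topology making its characters continuous; for
  generators of the dual semigroup this is the Euclidean topology of the affine embedding.\<close>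

definition toric_topology :: "(real ^ 'n) set set \<Rightarrow> 'n point topology" where
  "toric_topology \<Sigma> = topology_generated_by
     {{x \<in> chart \<sigma>. the (x m) \<in> B} | \<sigma> m B. \<sigma> \<in> \<Sigma> \<and> m \<in> dual_semigroup \<sigma> \<and> open B}"

definition torus :: "'n::finite point set" where
  "torus = orbit {0}"

definition toric_divisor :: "(real ^ 'n) set set \<Rightarrow> (real ^ 'n) set \<Rightarrow> 'n point set" where
  "toric_divisor \<Sigma> \<rho> = toric_topology \<Sigma> closure_of orbit \<rho>"

lemma topspace_toric:
  assumes "fan \<Sigma>"
  shows "topspace (toric_topology \<Sigma>) = (\<Union>\<sigma>\<in>\<Sigma>. orbit \<sigma>)"
proof -
  have cone: "convex \<sigma>" "\<sigma> \<noteq> {}" if "\<sigma> \<in> \<Sigma>" for \<sigma>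
  proof -
    have "convex_cone \<sigma>"
      using assms that unfolding fan_def rational_polyhedral_cone_def
      by (metis convex_cone_convex_cone_hull)
    then show "convex \<sigma>" "\<sigma> \<noteq> {}" by (auto simp: convex_cone_def)
  qed
  have "topspace (toric_topology \<Sigma>) = (\<Union>\<sigma>\<in>\<Sigma>. chart \<sigma>)"
  proof -
    have "\<exists>S. (\<exists>\<sigma>' m B. S = {x \<in> chart \<sigma>'. the (x m) \<in> B} \<and> \<sigma>' \<in> \<Sigma> \<and>
             m \<in> dual_semigroup \<sigma>' \<and> open B) \<and> x \<in> S"
      if "\<sigma> \<in> \<Sigma>" "x \<in> chart \<sigma>" for \<sigma> x
      using that
      by (intro exI[of _ "{x \<in> chart \<sigma>. the (x 0) \<in> UNIV}"] conjI exI[of _ \<sigma>] exI[of _ 0]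
            exI[of _ UNIV]) (auto simp: dual_semigroup_def pairing_def)
    then show ?thesis
      unfolding toric_topology_def topology_generated_by_topspace by auto
  qed
  also have "\<dots> = (\<Union>\<sigma>\<in>\<Sigma>. orbit \<sigma>)"
  proof
    show "(\<Union>\<sigma>\<in>\<Sigma>. chart \<sigma>) \<subseteq> (\<Union>\<sigma>\<in>\<Sigma>. orbit \<sigma>)"
      using assms unfolding chart_def fan_def by blast
    have "orbit \<sigma> \<subseteq> chart \<sigma>" if "\<sigma> \<in> \<Sigma>" for \<sigma>
      using cone[OF that] face_of_refl unfolding chart_def by blast
    then show "(\<Union>\<sigma>\<in>\<Sigma>. orbit \<sigma>) \<subseteq> (\<Union>\<sigma>\<in>\<Sigma>. chart \<sigma>)"
      by blast
  qed
  finally show ?thesis .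
qed

lemma dual_semigroup_zero: "dual_semigroup {0} = UNIV"
  by (simp add: dual_semigroup_def pairing_def)

text \<open>The torus is \<open>(\<complex>\<^sup>*)\<^sup>n\<close>, a point \<open>t\<close> being identified with evaluation of Laurent monomials
  at \<open>t\<close>.\<close>

lemma torus_eq:
  "(torus :: 'n::finite point set) =
     (\<lambda>t m. Some (\<Prod>i\<in>UNIV. (t $ i) powi (m $ i))) ` {t :: complex ^ 'n. \<forall>i. t $ i \<noteq> 0}"
proof (intro set_eqI iffI)
  fix x :: "'n point"
  assume "x \<in> torus"
  then have tot: "x m \<noteq> None" and x0: "x 0 = Some 1"
    and mult: "the (x (a + b)) = the (x a) * the (x b)" and nz: "the (x m) \<noteq> 0" for m a b
    by (auto simp: torus_def orbit_def dual_semigroup_zero)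
  define f where "f m = the (x m)" for m
  define t :: "complex ^ 'n" where "t = (\<chi> i. f (axis i 1))"
  have f0: "f 0 = 1" and fadd: "f (a + b) = f a * f b" and fnz: "f a \<noteq> 0" for a b
    using x0 mult nz by (simp_all add: f_def)
  have fneg: "f (- a) = inverse (f a)" for a
    using fadd[of a "- a"] f0 fnz[of a] by (simp add: field_simps)
  have fnat: "f (axis i (int k)) = f (axis i 1) ^ k" for i k
  proof (induction k)
    case 0
    have "axis i (0 :: int) = 0" by (simp add: axis_def vec_eq_iff)
    then show ?case using f0 by (simp only: of_nat_0 power_0)
  next
    case (Suc k)
    have "axis i (int (Suc k)) = axis i 1 + axis i (int k)" by (simp add: axis_def vec_eq_iff)
    then show ?case using fadd Suc by simp
  qed
  have faxis: "f (axis i k) = t $ i powi k" for i k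
  proof (cases "k \<ge> 0")
    case True
    then show ?thesis using fnat[of i "nat k"] by (simp add: t_def power_int_def)
  next
    case False
    have "axis i k = - axis i (int (nat (- k)))" using False by (simp add: axis_def vec_eq_iff)
    then have "f (axis i k) = inverse (f (axis i (int (nat (- k)))))" using fneg by metis
    then show ?thesis using False fnat[of i "nat (- k)"]
      by (simp add: t_def power_int_def power_inverse)
  qed
  have fsum: "f (\<Sum>i\<in>I. g i) = (\<Prod>i\<in>I. f (g i))" if "finite I" for I :: "'n set" and g
    using that by (induction I) (simp_all add: f0 fadd)
  have "f m = (\<Prod>i\<in>UNIV. (t $ i) powi (m $ i))" for m
  proof -
    have "m = (\<Sum>i\<in>UNIV. axis i (m $ i))"
      by (simp add: vec_eq_iff axis_def)
    then show ?thesis using fsum[of UNIV "\<lambda>i. axis i (m $ i)"] faxis by simp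
  qed
  then have "x = (\<lambda>m. Some (\<Prod>i\<in>UNIV. (t $ i) powi (m $ i)))"
    using tot by (metis f_def option.collapse ext)
  moreover have "\<forall>i. t $ i \<noteq> 0" using fnz by (simp add: t_def)
  ultimately show "x \<in> (\<lambda>t m. Some (\<Prod>i\<in>UNIV. (t $ i) powi (m $ i))) `
      {t :: complex ^ 'n. \<forall>i. t $ i \<noteq> 0}"
    by blast
next
  fix x :: "'n point"
  assume "x \<in> (\<lambda>t m. Some (\<Prod>i\<in>UNIV. (t $ i) powi (m $ i))) `
      {t :: complex ^ 'n. \<forall>i. t $ i \<noteq> 0}"
  then show "x \<in> torus"
    by (auto simp: torus_def orbit_def dual_semigroup_zero power_int_add prod.distrib)
qed


section \<open>Holomorphic and meromorphic functions\<close>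

text \<open>\<open>F\<close> is given by a convergent power series in the first \<open>k\<close> variables near \<open>a\<close>; the
  other coordinates of the sequences \<open>a\<close> and \<open>z\<close> are irrelevant.\<close>

definition analytic_at_Ck :: "nat \<Rightarrow> ((nat \<Rightarrow> complex) \<Rightarrow> complex) \<Rightarrow> (nat \<Rightarrow> complex) \<Rightarrow> bool" where
  "analytic_at_Ck k F a \<longleftrightarrow> (\<exists>r>0. \<exists>c. \<forall>z. (\<forall>i<k. cmod (z i - a i) < r) \<longrightarrow>
     ((\<lambda>\<alpha>. c \<alpha> * (\<Prod>i<k. (z i - a i) ^ \<alpha> i)) has_sum F z) (Pi\<^sub>E {..<k} (\<lambda>_. UNIV :: nat set)))"

text \<open>Holomorphic functions on the reduced analytic space: locally, restrictions of holomorphic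
  functions along the map to \<open>\<complex>\<^sup>k\<close> given by finitely many characters of a chart.  All characters of
  a chart are monomials in generators of its dual semigroup, so it makes no difference whether the
  characters are required to generate.\<close>

definition hol_on :: "(real ^ 'n) set set \<Rightarrow> 'n point set \<Rightarrow> ('n point \<Rightarrow> complex) \<Rightarrow> bool" where
  "hol_on \<Sigma> W f \<longleftrightarrow> openin (toric_topology \<Sigma>) W \<and>
     (\<forall>x\<in>W. \<exists>\<sigma>\<in>\<Sigma>. \<exists>k m F W'. (\<forall>i<k. m i \<in> dual_semigroup \<sigma>) \<and>
        analytic_at_Ck k F (\<lambda>i. the (x (m i))) \<and>
        openin (toric_topology \<Sigma>) W' \<and> x \<in> W' \<and> W' \<subseteq> W \<inter> chart \<sigma> \<and>
        (\<forall>y\<in>W'. f y = F (\<lambda>i. the (y (m i)))))"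

text \<open>A section over \<open>U\<close> of the sheaf of meromorphic functions is represented by the partial
  function given by its holomorphic values, with the complement of its polar set as domain: locally
  it is a fraction \<open>p / q\<close> with \<open>q\<close> a non-zero-divisor (its zero set has empty
  interior), and the last conjunct says that the domain is as large as possible.  The
  representation is unique, restriction of sections is restriction of partial functions, and the
  sections of the structure sheaf are those with domain \<open>U\<close>.\<close>

definition mero_sections ::
    "(real ^ 'n) set set \<Rightarrow> 'n point set \<Rightarrow> ('n point \<Rightarrow> complex option) set" where
  "mero_sections \<Sigma> U = {g. openin (toric_topology \<Sigma>) U \<and> dom g \<subseteq> U \<and>
     hol_on \<Sigma> (dom g) (\<lambda>x. the (g x)) \<and>
     (\<forall>x\<in>U. \<exists>W p q. x \<in> W \<and> W \<subseteq> U \<and> hol_on \<Sigma> W p \<and> hol_on \<Sigma> W q \<and>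
        toric_topology \<Sigma> interior_of {y\<in>W. q y = 0} = {} \<and>
        (\<forall>y\<in>W. q y \<noteq> 0 \<longrightarrow> g y = Some (p y / q y))) \<and>
     (\<forall>W f. W \<subseteq> U \<and> hol_on \<Sigma> W f \<and> (\<forall>y\<in>W \<inter> dom g. the (g y) = f y) \<longrightarrow> W \<subseteq> dom g)}"


section \<open>Order of vanishing\<close>

text \<open>\<open>t\<close> generates the ideal of germs at \<open>x\<close> of holomorphic functions vanishing on \<open>D\<close>.\<close>

definition local_equation ::
    "(real ^ 'n) set set \<Rightarrow> 'n point set \<Rightarrow> 'n point \<Rightarrow> 'n point set \<Rightarrow>
       ('n point \<Rightarrow> complex) \<Rightarrow> bool" where
  "local_equation \<Sigma> D x W t \<longleftrightarrow> x \<in> W \<and> hol_on \<Sigma> W t \<and> (\<forall>y\<in>D \<inter> W. t y = 0) \<and>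
     (\<forall>W' f. x \<in> W' \<and> hol_on \<Sigma> W' f \<and> (\<forall>y\<in>D \<inter> W'. f y = 0) \<longrightarrow>
        (\<exists>W'' a. x \<in> W'' \<and> W'' \<subseteq> W \<inter> W' \<and> hol_on \<Sigma> W'' a \<and> (\<forall>y\<in>W''. f y = a y * t y)))"

definition hol_ord_at ::
    "(real ^ 'n) set set \<Rightarrow> 'n point set \<Rightarrow> 'n point \<Rightarrow> ('n point \<Rightarrow> complex) \<Rightarrow> ereal" where
  "hol_ord_at \<Sigma> D x f = Sup {ereal (real k) | k. \<exists>W t W' a. local_equation \<Sigma> D x W t \<and>
     x \<in> W' \<and> W' \<subseteq> W \<and> hol_on \<Sigma> W' a \<and> (\<forall>y\<in>W'. f y = a y * t y ^ k)}"

definition mero_ord_at ::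
    "(real ^ 'n) set set \<Rightarrow> 'n point set \<Rightarrow> 'n point \<Rightarrow> ('n point \<Rightarrow> complex option) \<Rightarrow> ereal" where
  "mero_ord_at \<Sigma> D x g = (THE v. \<exists>W p q. x \<in> W \<and> hol_on \<Sigma> W p \<and> hol_on \<Sigma> W q \<and>
     toric_topology \<Sigma> interior_of {y\<in>W. q y = 0} = {} \<and>
     (\<forall>y\<in>W. q y \<noteq> 0 \<longrightarrow> g y = Some (p y / q y)) \<and>
     v = hol_ord_at \<Sigma> D x p - hol_ord_at \<Sigma> D x q)"

text \<open>The order along the divisor of a ray is computed at points of the dense orbit of the divisor,
  where both the divisor and the ambient variety are smooth.  It is constant on each connected
  component of the divisor inside \<open>U\<close>; if there are several, the minimum is taken, so that a lower
  bound on it is a lower bound along every component.\<close>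

definition ord_along ::
    "(real ^ 'n) set set \<Rightarrow> (real ^ 'n) set \<Rightarrow> 'n point set \<Rightarrow> ('n point \<Rightarrow> complex option) \<Rightarrow> ereal" where
  "ord_along \<Sigma> \<rho> U g = (INF x \<in> U \<inter> orbit \<rho>. mero_ord_at \<Sigma> (toric_divisor \<Sigma> \<rho>) x g)"

text \<open>The divisor is given by its coefficients on the rays.  As the complement of the torus is the
  union of the divisors of the rays, a pole outside these is a pole in the torus.\<close>

definition divisor_sections ::
    "(real ^ 'n) set set \<Rightarrow> ((real ^ 'n) set \<Rightarrow> nat) \<Rightarrow> 'n point set \<Rightarrow>
       ('n point \<Rightarrow> complex option) set" where
  "divisor_sections \<Sigma> E U = {g \<in> mero_sections \<Sigma> U. U \<inter> torus \<subseteq> dom g \<and>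
     (\<forall>\<rho>\<in>rays \<Sigma>. toric_divisor \<Sigma> \<rho> \<inter> U \<noteq> {} \<longrightarrow> - ereal (real (E \<rho>)) \<le> ord_along \<Sigma> \<rho> U g)}"


section \<open>Coherent analytic subsheaves of the sheaf of meromorphic functions\<close>

text \<open>A subsheaf is given by its sections; its values on sets that are not open are irrelevant.\<close>

type_synonym 'n section_family = "'n point set \<Rightarrow> ('n point \<Rightarrow> complex option) set"

text \<open>\<open>g\<close> is the meromorphic function \<open>\<Sum>i<k. a i \<cdot> s i\<close> on \<open>U\<close>; meromorphic functions agree
  if they agree where all of them are regular, which is a dense open set.\<close>

definition mero_lincomb ::
    "(real ^ 'n) set set \<Rightarrow> 'n point set \<Rightarrow> nat \<Rightarrow> (nat \<Rightarrow> 'n point \<Rightarrow> complex) \<Rightarrow>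
       (nat \<Rightarrow> 'n point \<Rightarrow> complex option) \<Rightarrow> ('n point \<Rightarrow> complex option) \<Rightarrow> bool" where
  "mero_lincomb \<Sigma> U k a s g \<longleftrightarrow> (\<forall>i<k. hol_on \<Sigma> U (a i)) \<and> g \<in> mero_sections \<Sigma> U \<and>
     (\<forall>x \<in> dom g \<inter> (\<Inter>i<k. dom (s i)). the (g x) = (\<Sum>i<k. a i x * the (s i x)))"

definition analytic_subsheaf :: "(real ^ 'n) set set \<Rightarrow> 'n section_family \<Rightarrow> bool" where
  "analytic_subsheaf \<Sigma> F \<longleftrightarrow> (\<forall>U. openin (toric_topology \<Sigma>) U \<longrightarrow>
     F U \<subseteq> mero_sections \<Sigma> U \<and>
     (\<forall>g\<in>F U. \<forall>W. openin (toric_topology \<Sigma>) W \<and> W \<subseteq> U \<longrightarrow> g |` W \<in> F W) \<and>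
     (\<forall>g\<in>mero_sections \<Sigma> U.
        (\<forall>x\<in>U. \<exists>W. openin (toric_topology \<Sigma>) W \<and> x \<in> W \<and> W \<subseteq> U \<and> g |` W \<in> F W) \<longrightarrow> g \<in> F U) \<and>
     (\<forall>k a s g. (\<forall>i<k. s i \<in> F U) \<and> mero_lincomb \<Sigma> U k a s g \<longrightarrow> g \<in> F U))"

definition generated_on ::
    "(real ^ 'n) set set \<Rightarrow> 'n section_family \<Rightarrow> 'n point set \<Rightarrow> nat \<Rightarrow>
       (nat \<Rightarrow> 'n point \<Rightarrow> complex option) \<Rightarrow> bool" where
  "generated_on \<Sigma> F W k s \<longleftrightarrow> (\<forall>i<k. s i \<in> F W) \<and>
     (\<forall>U g. openin (toric_topology \<Sigma>) U \<and> U \<subseteq> W \<and> g \<in> F U \<longrightarrow>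
        (\<forall>x\<in>U. \<exists>W' a. openin (toric_topology \<Sigma>) W' \<and> x \<in> W' \<and> W' \<subseteq> U \<and>
           mero_lincomb \<Sigma> W' k a (\<lambda>i. s i |` W') (g |` W')))"

definition finite_type :: "(real ^ 'n) set set \<Rightarrow> 'n section_family \<Rightarrow> bool" where
  "finite_type \<Sigma> F \<longleftrightarrow> (\<forall>x \<in> topspace (toric_topology \<Sigma>).
     \<exists>W k s. openin (toric_topology \<Sigma>) W \<and> x \<in> W \<and> generated_on \<Sigma> F W k s)"

definition is_relation ::
    "(real ^ 'n) set set \<Rightarrow> 'n point set \<Rightarrow> nat \<Rightarrow> (nat \<Rightarrow> 'n point \<Rightarrow> complex option) \<Rightarrow>
       (nat \<Rightarrow> 'n point \<Rightarrow> complex) \<Rightarrow> bool" where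
  "is_relation \<Sigma> U k s r \<longleftrightarrow> mero_lincomb \<Sigma> U k r (\<lambda>i. s i |` U) ((\<lambda>_. Some 0) |` U)"

definition relations_finite_type ::
    "(real ^ 'n) set set \<Rightarrow> 'n point set \<Rightarrow> nat \<Rightarrow> (nat \<Rightarrow> 'n point \<Rightarrow> complex option) \<Rightarrow> bool" where
  "relations_finite_type \<Sigma> W k s \<longleftrightarrow> (\<forall>x\<in>W. \<exists>W' (l :: nat) R.
     openin (toric_topology \<Sigma>) W' \<and> x \<in> W' \<and> W' \<subseteq> W \<and> (\<forall>j<l. is_relation \<Sigma> W' k s (R j)) \<and>
     (\<forall>U r. openin (toric_topology \<Sigma>) U \<and> U \<subseteq> W' \<and> is_relation \<Sigma> U k s r \<longrightarrow>
        (\<forall>y\<in>U. \<exists>W'' b. y \<in> W'' \<and> W'' \<subseteq> U \<and> (\<forall>j<l. hol_on \<Sigma> W'' (b j)) \<and>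
           openin (toric_topology \<Sigma>) W'' \<and>
           (\<forall>i<k. \<forall>z\<in>W''. r i z = (\<Sum>j<l. b j z * R j i z)))))"

definition coherent_subsheaf :: "(real ^ 'n) set set \<Rightarrow> 'n section_family \<Rightarrow> bool" where
  "coherent_subsheaf \<Sigma> F \<longleftrightarrow> analytic_subsheaf \<Sigma> F \<and> finite_type \<Sigma> F \<and>
     (\<forall>W k s. openin (toric_topology \<Sigma>) W \<and> (\<forall>i<k. s i \<in> F W) \<longrightarrow>
        relations_finite_type \<Sigma> W k s)"


section \<open>Analytic subvarieties of the torus and finite logarithmic type\<close>

text \<open>A reduced subvariety is given by its set of points.  Closedness in the torus is implied, as
  the local equations are required at every point of the torus.\<close>

definition analytic_subvariety :: "(real ^ 'n) set set \<Rightarrow> 'n point set \<Rightarrow> bool" where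
  "analytic_subvariety \<Sigma> V \<longleftrightarrow> V \<subseteq> torus \<and>
     (\<forall>x\<in>torus. \<exists>W fs. openin (toric_topology \<Sigma>) W \<and> x \<in> W \<and> W \<subseteq> torus \<and> finite fs \<and>
        (\<forall>f\<in>fs. hol_on \<Sigma> W f) \<and> V \<inter> W = {y\<in>W. \<forall>f\<in>fs. f y = 0})"

definition ideal_sections :: "(real ^ 'n) set set \<Rightarrow> 'n point set \<Rightarrow> 'n section_family" where
  "ideal_sections \<Sigma> V U =
     {g. dom g = U \<and> hol_on \<Sigma> U (\<lambda>x. the (g x)) \<and> (\<forall>x\<in>V \<inter> U. g x = Some 0)}"

definition restricts_to_ideal ::
    "(real ^ 'n) set set \<Rightarrow> 'n point set \<Rightarrow> 'n section_family \<Rightarrow> bool" where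
  "restricts_to_ideal \<Sigma> V F \<longleftrightarrow>
     (\<forall>U. openin (toric_topology \<Sigma>) U \<and> U \<subseteq> torus \<longrightarrow> F U = ideal_sections \<Sigma> V U)"

definition finite_log_type :: "(real ^ 'n) set set \<Rightarrow> 'n point set \<Rightarrow> bool" where
  "finite_log_type \<Sigma> V \<longleftrightarrow> (\<exists>E J. coherent_subsheaf \<Sigma> J \<and>
     (\<forall>U. openin (toric_topology \<Sigma>) U \<longrightarrow> J U \<subseteq> divisor_sections \<Sigma> E U) \<and>
     restricts_to_ideal \<Sigma> V J)"

end

(* The same sheaf and the same multiplicities serve in both directions.  The only point is that a
   section g of F over U has no poles in the torus: the torus is open, so g restricts to a section
   of F = I_V over U \<inter> torus, and sections of I_V are holomorphic. *)

theory Submission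
  imports Defs
begin

text \<open>If 0 lies strictly between two points \<open>a\<close> and \<open>b\<close> of the cone,
  then a positive multiple of \<open>b\<close> is the negative of a positive multiple of
  \<open>a\<close>. It thus lies in both the cone and its negative, which by strong convexity meet
  only in 0.\<close>

lemma zero_face_of_strongly_convex_cone:
  assumes "convex_cone \<sigma>" and "strongly_convex \<sigma>"
  shows "{0} face_of \<sigma>"
proof -
  have both_zero: "a = 0 \<and> b = 0"
    if "a \<in> \<sigma>" "b \<in> \<sigma>" and seg: "0 \<in> open_segment a b" for a b
  proof -
    obtain u where u: "0 < u" "u < 1" and eq: "(1 - u) *\<^sub>R a + u *\<^sub>R b = 0" and "a \<noteq> b"
      using seg by (auto simp: in_segment)
    have scaled: "(1 - u) *\<^sub>R a \<in> \<sigma>" "u *\<^sub>R b \<in> \<sigma>"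
      using that u assms(1) by (auto simp: convex_cone_def conic_def)
    have "u *\<^sub>R b = - ((1 - u) *\<^sub>R a)"
      using eq by (simp add: eq_neg_iff_add_eq_0 add.commute)
    with scaled have "u *\<^sub>R b \<in> \<sigma> \<inter> uminus ` \<sigma>"
      by blast
    then have "u *\<^sub>R b = 0"
      using assms(2) unfolding strongly_convex_def by blast
    \<comment> \<open>As \<open>u\<close> is neither 0 nor 1, both coefficients cancel: first
      \<open>b\<close> vanishes, then \<open>a\<close> by \<open>eq\<close>.\<close>
    with u eq show ?thesis
      by auto
  qed
  have "0 \<in> \<sigma>"
    using assms(2) by (auto simp: strongly_convex_def)
  with both_zero show ?thesis
    by (auto simp: face_of_def)
qed

text \<open>A fan is nonempty and closed under nonempty faces, so it contains the vertex of any of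
  its cones.\<close>

lemma zero_cone_in_fan:
  assumes "fan \<Sigma>"
  shows "{0} \<in> \<Sigma>"
proof -
  obtain \<sigma> where "\<sigma> \<in> \<Sigma>" "rational_polyhedral_cone \<sigma>" "strongly_convex \<sigma>"
    using assms unfolding fan_def by blast
  moreover from this have "convex_cone \<sigma>"
    unfolding rational_polyhedral_cone_def by (metis convex_cone_convex_cone_hull)
  ultimately show ?thesis
    using assms zero_face_of_strongly_convex_cone unfolding fan_def by blast
qed

text \<open>The torus is the chart of the zero cone, and the chart of each cone of the fan is open
  by construction of the topology.\<close>

lemma openin_torus:
  fixes \<Sigma> :: "(real ^ 'n) set set"
  assumes "fan \<Sigma>"
  shows "openin (toric_topology \<Sigma>) torus"
proof -
  have "{\<tau>. \<tau> face_of {0 :: real ^ 'n} \<and> \<tau> \<noteq> {}} = {{0}}"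
    by (auto simp: face_of_refl dest: face_of_imp_subset)
  then have "chart {0 :: real ^ 'n} = torus"
    unfolding chart_def torus_def by (simp only: UN_insert UN_empty Un_empty_right)
  \<comment> \<open>The character 0 with target \<open>UNIV\<close> imposes no condition, so the
    whole chart takes the form of a generator of the topology.\<close>
  then have "torus = {x \<in> chart {0 :: real ^ 'n}. the (x 0) \<in> UNIV}"
    by simp
  then show ?thesis
    unfolding toric_topology_def
    using zero_cone_in_fan[OF assms]
    by (intro topology_generated_by_Basis CollectI exI[of _ "{0}"] exI[of _ 0] exI[of _ UNIV])
      (simp add: dual_semigroup_zero)
qed

lemma analytic_subsheaf_mero_sections:
  assumes "analytic_subsheaf \<Sigma> F" and "openin (toric_topology \<Sigma>) U" and "g \<in> F U"
  shows "g \<in> mero_sections \<Sigma> U"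
  using assms(1)[unfolded analytic_subsheaf_def, rule_format, OF assms(2), THEN conjunct1] assms(3)
  by (rule subsetD)

lemma analytic_subsheaf_restrict:
  assumes "analytic_subsheaf \<Sigma> F" and "openin (toric_topology \<Sigma>) U" and "g \<in> F U"
    and "openin (toric_topology \<Sigma>) W" and "W \<subseteq> U"
  shows "g |` W \<in> F W"
  using assms(1)[unfolded analytic_subsheaf_def, THEN spec, THEN mp, OF assms(2),
      THEN conjunct2, THEN conjunct1] assms(3-5)
  by simp

lemma sections_regular_on_torus:
  assumes "fan \<Sigma>" and "analytic_subsheaf \<Sigma> F" and "restricts_to_ideal \<Sigma> V F"
    and "openin (toric_topology \<Sigma>) U" and "g \<in> F U"
  shows "U \<inter> torus \<subseteq> dom g"
proof -
  \<comment> \<open>\<open>restricts_to_ideal\<close> describes \<open>F\<close> only on open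
    subsets of the torus, hence the need for openness here.\<close>
  have op: "openin (toric_topology \<Sigma>) (U \<inter> torus)"
    using assms(1,4) by (intro openin_Int openin_torus)
  then have "g |` (U \<inter> torus) \<in> F (U \<inter> torus)"
    using analytic_subsheaf_restrict assms(2,4,5) Int_lower1 by metis
  also have "F (U \<inter> torus) = ideal_sections \<Sigma> V (U \<inter> torus)"
    using assms(3) op unfolding restricts_to_ideal_def by simp
  \<comment> \<open>The domain of a section omits its polar set, whereas a section of the ideal
    sheaf is defined on its whole open set; so \<open>g\<close> has no pole in
    \<open>U \<inter> torus\<close>.\<close>
  finally show ?thesis
    by (auto simp: ideal_sections_def)
qed

theorem theorem4p1:
  fixes \<Sigma> :: "(real ^ 'n) set set" and V :: "'n point set"
  assumes "fan \<Sigma>"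
    and "compact_space (toric_topology \<Sigma>)"
    and "analytic_subvariety \<Sigma> V"
  shows "finite_log_type \<Sigma> V \<longleftrightarrow>
    (\<exists>F (M :: (real ^ 'n) set \<Rightarrow> nat).
       coherent_subsheaf \<Sigma> F \<and> restricts_to_ideal \<Sigma> V F \<and>
       (\<forall>U g \<rho>. openin (toric_topology \<Sigma>) U \<and> g \<in> F U \<and> \<rho> \<in> rays \<Sigma> \<and>
          toric_divisor \<Sigma> \<rho> \<inter> U \<noteq> {} \<longrightarrow> - ereal (real (M \<rho>)) \<le> ord_along \<Sigma> \<rho> U g))"
  (is "_ \<longleftrightarrow> ?bounded")
proof
  assume "finite_log_type \<Sigma> V"
  then obtain E J where J: "coherent_subsheaf \<Sigma> J" "restricts_to_ideal \<Sigma> V J"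
    and sub: "\<And>U. openin (toric_topology \<Sigma>) U \<Longrightarrow> J U \<subseteq> divisor_sections \<Sigma> E U"
    unfolding finite_log_type_def by blast
  have "- ereal (real (E \<rho>)) \<le> ord_along \<Sigma> \<rho> U g"
    if "openin (toric_topology \<Sigma>) U" "g \<in> J U" "\<rho> \<in> rays \<Sigma>" "toric_divisor \<Sigma> \<rho> \<inter> U \<noteq> {}"
    for U g \<rho>
    using subsetD[OF sub that(2)] that by (simp add: divisor_sections_def)
  with J show ?bounded
    by (intro exI[of _ J] exI[of _ E]) simp
next
  assume ?bounded
  then obtain F and M :: "(real ^ 'n) set \<Rightarrow> nat"
    where F: "coherent_subsheaf \<Sigma> F" "restricts_to_ideal \<Sigma> V F"
      and ord: "\<forall>U g \<rho>. openin (toric_topology \<Sigma>) U \<and> g \<in> F U \<and> \<rho> \<in> rays \<Sigma> \<and>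
          toric_divisor \<Sigma> \<rho> \<inter> U \<noteq> {} \<longrightarrow> - ereal (real (M \<rho>)) \<le> ord_along \<Sigma> \<rho> U g"
    by (elim exE conjE) (rule that)
  have sub: "analytic_subsheaf \<Sigma> F"
    using F(1) by (simp add: coherent_subsheaf_def)
  \<comment> \<open>With the bounds \<open>M\<close> as divisor coefficients, membership means being
    meromorphic, regular on the torus and of bounded pole order; the last is
    \<open>ord\<close>.\<close>
  have "F U \<subseteq> divisor_sections \<Sigma> M U" if U: "openin (toric_topology \<Sigma>) U" for U
  proof
    fix g assume g: "g \<in> F U"
    have "g \<in> mero_sections \<Sigma> U"
      by (rule analytic_subsheaf_mero_sections[OF sub U g])
    moreover have "U \<inter> torus \<subseteq> dom g"
      by (rule sections_regular_on_torus[OF assms(1) sub F(2) U g])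
    ultimately show "g \<in> divisor_sections \<Sigma> M U"
      using ord U g by (simp add: divisor_sections_def)
  qed
  with F show "finite_log_type \<Sigma> V"
    unfolding finite_log_type_def by (intro exI[of _ M] exI[of _ F]) simp
qed

end
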